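(* Let $G$ be a compact Hausdorff topological group having a (not necessarily continuous) automorphism $\alpha$ such that the set $X=\{x\in G : x^{\alpha}=x^{-1}\}$ is measurable and of positive Haar measure. Then $G$ contains an open normal abelian subgroup. In particular, if $G$ is profinite, there exists an open abelian subgroup $A$ of $G$ such that $tA\subseteq X$ for some $t\in X$.
   Context: An automorphism of $G$ here means an automorphism of the underlying abstract group; $x^{\alpha}$ denotes the image of $x$ under $\alpha$. Measurability and measure are with respect to the normalized Haar measure of $G$. A profinite group is a compact totally disconnected Hausdorff topological group. *)

theory Defs
  imports "HOL-Probability.Probability_Measure" "HOL-Algebra.Coset"
begin

locale topological_group = group G for G (structure) +
  fixes T :: "'a topology"
  assumes topspace_eq: "topspace T = carrier G"
    and continuous_mult: "continuous_map (prod_topology T T) T (\<lambda>(x, y). x \<otimes> y)"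
    and continuous_inv: "continuous_map T T (\<lambda>x. inv x)"

locale compact_Hausdorff_group = topological_group +
  assumes compact: "compact_space T"
    and Hausdorff: "Hausdorff_space T"

definition totally_disconnected_space :: "'a topology \<Rightarrow> bool" where
  "totally_disconnected_space T \<longleftrightarrow>
     (\<forall>S. connectedin T S \<longrightarrow> (\<forall>x\<in>S. \<forall>y\<in>S. x = y))"

locale profinite_group = compact_Hausdorff_group +
  assumes totally_disconnected: "totally_disconnected_space T"

(* Normalized Haar measure: the left-invariant regular Borel probability measure.
   Regularity cannot be dropped when the topology is not second countable,
   since uniqueness of the measure may fail without it. *)
locale normalized_Haar_measure =
  compact_Hausdorff_group G T + prob_space M
  for G (structure) and T and M :: "'a measure" +
  assumes space_eq: "space M = carrier G"
    and sets_eq: "sets M = sigma_sets (carrier G) {U. openin T U}"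
    and left_invariant:
      "\<And>g A. g \<in> carrier G \<Longrightarrow> A \<in> sets M \<Longrightarrow> emeasure M (g <# A) = emeasure M A"
    and outer_regular:
      "\<And>A. A \<in> sets M \<Longrightarrow>
        emeasure M A = (INF U \<in> {U. openin T U \<and> A \<subseteq> U}. emeasure M U)"
    and inner_regular:
      "\<And>U. openin T U \<Longrightarrow>
        emeasure M U = (SUP K \<in> {K. compactin T K \<and> K \<subseteq> U}. emeasure M K)"

end

theory Submission
  imports Defs
begin

text \<open>If \<open>x\<close> and \<open>ax\<close> lie in \<open>X\<close>, then \<open>\<alpha>\<close> sends \<open>a\<close> to the conjugate of \<open>a\<inverse>\<close> by \<open>x\<close>. For \<open>a, b\<close>
  close to \<open>1\<close>, a Steinhaus argument gives an \<open>x\<close> with \<open>x, ax, bx, abx \<in> X\<close>; comparing \<open>\<alpha> (ab)\<close> with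
  \<open>\<alpha> a \<alpha> b\<close> yields \<open>ab = ba\<close>. So a neighbourhood of \<open>1\<close> lies in an open abelian subgroup \<open>H\<close>,
  whose normal core is open by compactness.

  Some coset \<open>tH\<close> with \<open>t \<in> X\<close> meets \<open>X\<close> in positive measure. As \<open>H\<close> is abelian, the set \<open>A\<close> of
  \<open>n \<in> H\<close> with \<open>tn \<in> X\<close> is the set on which two homomorphisms \<open>H \<rightarrow> G\<close> agree, hence a
  subgroup, and the Steinhaus argument makes it open.\<close>

section \<open>Continuity of the group operations and open translates\<close>

context topological_group
begin

lemma continuous_map_mult:
  assumes "continuous_map X T f" "continuous_map X T g"
  shows "continuous_map X T (\<lambda>x. f x \<otimes> g x)"
  using continuous_map_compose[OF continuous_map_pairedI[OF assms] continuous_mult]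
  by (simp add: o_def)

lemma continuous_map_inv:
  assumes "continuous_map X T f"
  shows "continuous_map X T (\<lambda>x. inv (f x))"
  using continuous_map_compose[OF assms continuous_inv] by (simp add: o_def)

lemma continuous_map_const_carrier:
  "g \<in> carrier G \<Longrightarrow> continuous_map X T (\<lambda>_. g)"
  by (simp add: topspace_eq)

lemma openin_carrier: "openin T U \<Longrightarrow> U \<subseteq> carrier G"
  using openin_subset topspace_eq by blast

lemma openin_left_preimage:
  assumes "openin T U" "g \<in> carrier G"
  shows "openin T {x \<in> carrier G. g \<otimes> x \<in> U}"
  using openin_continuous_map_preimage[OF continuous_map_mult[OF
        continuous_map_const_carrier[OF assms(2)] continuous_map_id[unfolded id_def]] assms(1)]
  by (simp add: topspace_eq)

text \<open>Presents a translate as a preimage under left multiplication by \<open>inv g\<close>, so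
  that continuity makes translates of open sets open and of closed sets closed.\<close>

lemma l_coset_eq_preimage:
  assumes "A \<subseteq> carrier G" "g \<in> carrier G"
  shows "g <# A = {x \<in> carrier G. inv g \<otimes> x \<in> A}"
proof -
  have "x \<in> g <# A" if "x \<in> carrier G" "inv g \<otimes> x \<in> A" for x
  proof -
    have "x = g \<otimes> (inv g \<otimes> x)" using that assms by (simp add: m_assoc[symmetric])
    then show ?thesis using that by (auto simp: l_coset_def)
  qed
  then show ?thesis
    using assms by (auto simp: l_coset_def m_assoc[symmetric] subset_iff)
qed

lemma openin_l_coset:
  assumes "openin T U" "g \<in> carrier G"
  shows "openin T (g <# U)"
  using openin_left_preimage[OF assms(1), of "inv g"] assms
  by (simp add: l_coset_eq_preimage openin_carrier)

text \<open>For each h in \<open>H\<close> the translate hU is an open neighbourhood of h, and it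
  stays inside \<open>H\<close> because \<open>H\<close> is closed under products.\<close>

lemma openin_subgroup:
  assumes H: "subgroup H G" and U: "openin T U" "\<one> \<in> U" "U \<subseteq> H"
  shows "openin T H"
proof -
  have "\<exists>V. openin T V \<and> h \<in> V \<and> V \<subseteq> H" if "h \<in> H" for h
  proof (intro exI conjI)
    have h: "h \<in> carrier G" using subgroup.mem_carrier[OF H that] .
    show "openin T (h <# U)" using openin_l_coset[OF U(1) h] .
    show "h \<in> h <# U" using U(2) h by (force simp: l_coset_def)
    show "h <# U \<subseteq> H" using U(3) that subgroup.m_closed[OF H] by (auto simp: l_coset_def)
  qed
  then show ?thesis by (subst openin_subopen) blast
qed

end

section \<open>Centralizers, abelian subgroups and normal cores in an abstract group\<close>

context group
begin

definition centralizer :: "'a set \<Rightarrow> 'a set" where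
  "centralizer S = {g \<in> carrier G. \<forall>s\<in>S. g \<otimes> s = s \<otimes> g}"

lemma subgroup_centralizer:
  assumes "S \<subseteq> carrier G"
  shows "subgroup (centralizer S) G"
proof (rule subgroupI)
  show "centralizer S \<subseteq> carrier G" by (auto simp: centralizer_def)
  show "centralizer S \<noteq> {}" using assms by (auto simp: centralizer_def intro!: exI[of _ \<one>])
next
  fix a assume a: "a \<in> centralizer S"
  have "inv a \<otimes> s = s \<otimes> inv a" if "s \<in> S" for s
  proof -
    have c: "a \<in> carrier G" "s \<in> carrier G" "a \<otimes> s = s \<otimes> a"
      using a that assms by (auto simp: centralizer_def)
    have "inv a \<otimes> s = inv a \<otimes> (s \<otimes> a) \<otimes> inv a" using c(1,2) by (simp add: m_assoc)
    also have "\<dots> = s \<otimes> inv a" using c(1,2) by (simp add: c(3)[symmetric] m_assoc[symmetric])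
    finally show ?thesis .
  qed
  then show "inv a \<in> centralizer S" using a by (auto simp: centralizer_def)
next
  fix a b assume ab: "a \<in> centralizer S" "b \<in> centralizer S"
  have "a \<otimes> b \<otimes> s = s \<otimes> (a \<otimes> b)" if "s \<in> S" for s
  proof -
    have c: "a \<in> carrier G" "b \<in> carrier G" "s \<in> carrier G" "a \<otimes> s = s \<otimes> a" "b \<otimes> s = s \<otimes> b"
      using ab that assms by (auto simp: centralizer_def)
    have "a \<otimes> b \<otimes> s = a \<otimes> s \<otimes> b" using c(1-3) by (simp add: m_assoc c(5))
    also have "\<dots> = s \<otimes> (a \<otimes> b)" using c(1-3) by (simp add: m_assoc c(4))
    finally show ?thesis .
  qed
  then show "a \<otimes> b \<in> centralizer S" using ab by (auto simp: centralizer_def)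
qed

lemma comm_group_subgroupI:
  assumes "subgroup H G" and "\<And>x y. x \<in> H \<Longrightarrow> y \<in> H \<Longrightarrow> x \<otimes> y = y \<otimes> x"
  shows "comm_group (G\<lparr>carrier := H\<rparr>)"
  using group.group_comm_groupI[OF subgroup_imp_group[OF assms(1)]] assms(2) by simp

text \<open>The witness is the double centralizer. Since \<open>U\<close> commutes with itself, it
  lies in its own centralizer C; hence the centralizer of C lies in C, and so its elements commute
  with one another.\<close>

lemma abelian_subgroup_of_commuting_set:
  assumes "U \<subseteq> carrier G" and "\<And>x y. x \<in> U \<Longrightarrow> y \<in> U \<Longrightarrow> x \<otimes> y = y \<otimes> x"
  obtains H where "subgroup H G" "U \<subseteq> H" "\<And>x y. x \<in> H \<Longrightarrow> y \<in> H \<Longrightarrow> x \<otimes> y = y \<otimes> x"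
proof
  let ?C = "centralizer U"
  show "subgroup (centralizer ?C) G"
    by (rule subgroup_centralizer) (auto simp: centralizer_def)
  show "U \<subseteq> centralizer ?C" using assms by (auto simp: centralizer_def)
  show "x \<otimes> y = y \<otimes> x" if "x \<in> centralizer ?C" "y \<in> centralizer ?C" for x y
  proof -
    have "y \<in> centralizer U" using assms that(2) by (auto simp: centralizer_def)
    then show ?thesis using that(1) by (simp add: centralizer_def)
  qed
qed

text \<open>The intersection of all conjugates of \<open>H\<close>. The pointwise form, with g
  ranging over the whole group, is the shape to which \<open>openin_Collect_ball\<close>
  applies.\<close>

definition core :: "'a set \<Rightarrow> 'a set" where
  "core H = {n \<in> carrier G. \<forall>g\<in>carrier G. g \<otimes> n \<otimes> inv g \<in> H}"

lemma core_subset: "core H \<subseteq> H"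
proof
  fix n assume "n \<in> core H"
  then have "n \<in> carrier G" "\<one> \<otimes> n \<otimes> inv \<one> \<in> H"
    unfolding core_def by blast+
  then show "n \<in> H" by simp
qed

lemma normal_core:
  assumes H: "subgroup H G"
  shows "core H \<lhd> G"
proof -
  have conj_mult: "g \<otimes> (a \<otimes> b) \<otimes> inv g = (g \<otimes> a \<otimes> inv g) \<otimes> (g \<otimes> b \<otimes> inv g)"
    if "a \<in> carrier G" "b \<in> carrier G" "g \<in> carrier G" for a b g
  proof -
    have "(g \<otimes> a \<otimes> inv g) \<otimes> (g \<otimes> b \<otimes> inv g) = g \<otimes> a \<otimes> (inv g \<otimes> g) \<otimes> b \<otimes> inv g"
      using that by (simp only: m_assoc m_closed inv_closed)
    then show ?thesis using that by (simp add: m_assoc)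
  qed
  have conj_inv: "g \<otimes> inv a \<otimes> inv g = inv (g \<otimes> a \<otimes> inv g)"
    if "a \<in> carrier G" "g \<in> carrier G" for a g
    using that by (simp add: inv_mult_group m_assoc)
  have conj_conj: "g \<otimes> (h \<otimes> a \<otimes> inv h) \<otimes> inv g = (g \<otimes> h) \<otimes> a \<otimes> inv (g \<otimes> h)"
    if "a \<in> carrier G" "g \<in> carrier G" "h \<in> carrier G" for a g h
    using that by (simp add: inv_mult_group m_assoc)
  have "subgroup (core H) G"
  proof (rule subgroupI)
    show "core H \<subseteq> carrier G" by (auto simp: core_def)
    show "core H \<noteq> {}"
      using subgroup.one_closed[OF H] by (auto simp: core_def intro!: exI[of _ \<one>])
    show "inv a \<in> core H" if "a \<in> core H" for a
      using that subgroup.m_inv_closed[OF H] by (auto simp: core_def conj_inv)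
    show "a \<otimes> b \<in> core H" if "a \<in> core H" "b \<in> core H" for a b
      using that subgroup.m_closed[OF H] by (auto simp: core_def conj_mult)
  qed
  then show ?thesis
    by (auto simp: normal_inv_iff core_def conj_conj)
qed

end

section \<open>Consequences of compactness\<close>

context compact_Hausdorff_group
begin

text \<open>A form of the tube lemma. The complement is the first projection of the set
  \<open>?B\<close> of pairs (x, y) with y in \<open>C\<close> and f x y outside \<open>V\<close>.
  This set is closed in the product, and projection along a compact factor is a closed map.\<close>

lemma openin_Collect_ball:
  assumes f: "continuous_map (prod_topology T T) T (\<lambda>(x, y). f x y)"
    and C: "closedin T C" and V: "openin T V"
  shows "openin T {x \<in> carrier G. \<forall>y\<in>C. f x y \<in> V}"
proof -
  let ?P = "prod_topology T T"
  let ?B = "{p \<in> topspace ?P. (\<lambda>(x, y). f x y) p \<in> topspace T - V} \<inter> topspace T \<times> C"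
  have CT: "C \<subseteq> topspace T" using C closedin_subset by blast
  have fT: "f x y \<in> topspace T" if "x \<in> topspace T" "y \<in> topspace T" for x y
    using continuous_map_funspace[OF f] that by (auto simp: Pi_iff)
  have "closedin ?P ?B"
    using closedin_continuous_map_preimage[OF f, of "topspace T - V"] V C
    by (intro closedin_Int) (auto simp: closedin_prod_Times_iff)
  then have "closedin T (fst ` ?B)"
    using closed_map_fst[OF compact] unfolding closed_map_def by blast
  moreover have "fst ` ?B = topspace T - {x \<in> carrier G. \<forall>y\<in>C. f x y \<in> V}"
  proof (intro equalityI subsetI)
    fix x assume "x \<in> topspace T - {x \<in> carrier G. \<forall>y\<in>C. f x y \<in> V}"
    then obtain y where "x \<in> topspace T" "y \<in> C" "f x y \<notin> V" by (auto simp: topspace_eq)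
    then have "(x, y) \<in> ?B" using CT fT by auto
    then show "x \<in> fst ` ?B" by force
  qed (auto simp: topspace_eq)
  ultimately show ?thesis by (simp add: closedin_def topspace_eq Diff_Diff_Int Int_absorb1)
qed

text \<open>The conjugating element ranges over the whole space, which is closed, so the tube
  argument makes an infinite intersection of conjugates open.\<close>

lemma openin_core:
  assumes "openin T H"
  shows "openin T (core H)"
proof -
  have 1: "continuous_map (prod_topology T T) T (\<lambda>(n, g). g \<otimes> n \<otimes> inv g)"
    unfolding case_prod_beta
    by (intro continuous_map_mult continuous_map_inv continuous_map_fst continuous_map_snd)
  have "openin T {n \<in> carrier G. \<forall>g\<in>topspace T. g \<otimes> n \<otimes> inv g \<in> H}"
    using openin_Collect_ball[OF 1 closedin_topspace assms] .
  then show ?thesis by (simp add: core_def topspace_eq)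
qed

lemma finite_l_coset_cover:
  assumes "openin T H" "\<one> \<in> H"
  obtains F where "finite F" "F \<subseteq> carrier G" "carrier G = (\<Union>g\<in>F. g <# H)"
proof -
  have H: "H \<subseteq> carrier G" using openin_carrier[OF assms(1)] .
  have "\<And>U. U \<in> (\<lambda>g. g <# H) ` carrier G \<Longrightarrow> openin T U"
    using openin_l_coset[OF assms(1)] by auto
  moreover have "topspace T \<subseteq> \<Union>((\<lambda>g. g <# H) ` carrier G)"
    using assms(2) by (force simp: topspace_eq l_coset_def)
  ultimately obtain D where D: "finite D" "D \<subseteq> (\<lambda>g. g <# H) ` carrier G" "topspace T \<subseteq> \<Union>D"
    using compact unfolding compact_space_alt by meson
  then obtain F where F: "F \<subseteq> carrier G" "finite F" "D = (\<lambda>g. g <# H) ` F"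
    by (meson finite_subset_image)
  have "carrier G = (\<Union>g\<in>F. g <# H)"
    using D(3) F H by (auto simp: topspace_eq l_coset_def)
  then show thesis using F that by blast
qed

end

section \<open>Regularity of Haar measure and the Steinhaus argument\<close>

context normalized_Haar_measure
begin

lemma sets_openin: "openin T U \<Longrightarrow> U \<in> sets M"
  by (simp add: sets_eq)

lemma sets_closedin:
  assumes "closedin T C"
  shows "C \<in> sets M"
proof -
  have "space M - (topspace T - C) \<in> sets M"
    using assms sets_openin by (intro sets.compl_sets) (auto simp: closedin_def)
  then show ?thesis
    using closedin_subset[OF assms] by (simp add: space_eq topspace_eq Diff_Diff_Int Int_absorb1)
qed

lemma outer_openin:
  assumes "A \<in> sets M" "measure M A < r"
  obtains U where "openin T U" "A \<subseteq> U" "measure M U < r"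
proof -
  have "emeasure M A < ennreal r"
    using assms by (simp add: emeasure_eq_measure ennreal_less_iff)
  then obtain U where "openin T U" "A \<subseteq> U" "emeasure M U < ennreal r"
    unfolding outer_regular[OF assms(1)] by (auto simp: INF_less_iff)
  then show thesis using that by (simp add: emeasure_eq_measure ennreal_less_iff)
qed

text \<open>The axiom \<open>inner_regular\<close> speaks of open sets, whereas \<open>S\<close> is
  any measurable set. Outer regularity of the complement of \<open>S\<close> gives an open
  \<open>W\<close> of measure below 1 around it, and the complement of \<open>W\<close> is the
  closed set.\<close>

lemma inner_closedin:
  assumes "S \<in> sets M" "measure M S > 0"
  obtains K where "closedin T K" "K \<subseteq> S" "measure M K > 0"
proof -
  have "measure M (space M - S) < 1" using assms by (simp add: prob_compl)
  then obtain W where W: "openin T W" "space M - S \<subseteq> W" "measure M W < 1"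
    using outer_openin[of "space M - S" 1] assms by (metis sets.compl_sets)
  have "measure M (space M - W) > 0" using W by (simp add: prob_compl sets_openin)
  then show thesis
    using that[of "space M - W"] W sets.sets_into_space[OF assms(1)]
    by (auto simp: space_eq topspace_eq[symmetric] closedin_diff)
qed

text \<open>A closed \<open>K \<subseteq> S\<close> has an open neighbourhood \<open>V\<close> of measure below \<open>4/3\<close> times that of \<open>K\<close>,
  so four translates of \<open>K\<close> inside \<open>V\<close> always have a common point.\<close>

lemma Steinhaus_parallelogram:
  assumes S: "S \<in> sets M" "measure M S > 0"
  obtains U where "openin T U" "\<one> \<in> U"
    "\<And>a b. a \<in> U \<Longrightarrow> b \<in> U \<Longrightarrow> \<exists>x\<in>S. a \<otimes> x \<in> S \<and> b \<otimes> x \<in> S \<and> (a \<otimes> b) \<otimes> x \<in> S"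
proof -
  obtain K where K: "closedin T K" "K \<subseteq> S" "measure M K > 0"
    using inner_closedin[OF S] .
  have Kc: "K \<subseteq> carrier G" using closedin_subset[OF K(1)] topspace_eq by simp
  have Ks: "K \<in> sets M" using sets_closedin[OF K(1)] .
  obtain V where V: "openin T V" "K \<subseteq> V" "measure M V < 4 / 3 * measure M K"
    using outer_openin[OF Ks, of "4 / 3 * measure M K"] K(3) by auto
  \<comment> \<open>The g with gK inside \<open>V\<close>. The tube argument makes this an open
    neighbourhood of \<open>\<one>\<close>.\<close>
  define E where "E = {g \<in> carrier G. \<forall>k\<in>K. g \<otimes> k \<in> V}"
  have E: "openin T E"
    unfolding E_def by (rule openin_Collect_ball[OF continuous_mult K(1) V(1)])
  have E1: "\<one> \<in> E" using V(2) Kc by (simp add: E_def subset_iff)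
  \<comment> \<open>The translates of \<open>K\<close> to be compared are by the inverses of
    \<open>\<one>\<close>, a, b and ab. Smallness is therefore imposed on the inverse of ab; setting
    b = \<open>\<one>\<close> then covers a single factor.\<close>
  have cont: "continuous_map (prod_topology T T) T (\<lambda>p. inv (fst p \<otimes> snd p))"
    by (intro continuous_map_mult continuous_map_inv continuous_map_fst continuous_map_snd)
  have "openin (prod_topology T T) {p \<in> topspace (prod_topology T T). inv (fst p \<otimes> snd p) \<in> E}"
    using openin_continuous_map_preimage[OF cont E] .
  moreover have "(\<one>, \<one>) \<in> {p \<in> topspace (prod_topology T T). inv (fst p \<otimes> snd p) \<in> E}"
    using E1 by (simp add: topspace_eq)
  ultimately obtain U1 U2 where U12: "openin T U1" "openin T U2" "\<one> \<in> U1" "\<one> \<in> U2"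
    "U1 \<times> U2 \<subseteq> {p \<in> topspace (prod_topology T T). inv (fst p \<otimes> snd p) \<in> E}"
    unfolding openin_prod_topology_alt by meson
  define U where "U = U1 \<inter> U2"
  have U: "openin T U" "\<one> \<in> U" using U12 by (auto simp: U_def)
  have Uc: "U \<subseteq> carrier G" using openin_carrier[OF U(1)] .
  have UE: "inv (a \<otimes> b) \<in> E" if "a \<in> U" "b \<in> U" for a b
    using U12(5) that by (auto simp: U_def)
  have UE1: "inv a \<in> E" if "a \<in> U" for a
    using UE[OF that U(2)] Uc that by (simp add: subset_iff)
  \<comment> \<open>The translate lies in \<open>V\<close> because \<open>inv c\<close> is in
    \<open>E\<close>. By invariance it has the measure of \<open>K\<close>, which exceeds 3/4 of
    that of \<open>V\<close>, so it misses less than a quarter of \<open>V\<close>.\<close>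
  have translate: "inv c <# K \<in> sets M" "measure M (V - (inv c <# K)) < measure M V / 4"
    "\<And>x. x \<in> inv c <# K \<Longrightarrow> c \<otimes> x \<in> K"
    if c: "c \<in> carrier G" "inv c \<in> E" for c
  proof -
    have eq: "inv c <# K = {x \<in> carrier G. c \<otimes> x \<in> K}"
      using l_coset_eq_preimage[OF Kc, of "inv c"] c by simp
    have "closedin T {x \<in> topspace T. c \<otimes> x \<in> K}"
      by (rule closedin_continuous_map_preimage[OF _ K(1)])
        (intro continuous_map_mult continuous_map_const_carrier c continuous_map_id[unfolded id_def])
    then show meas: "inv c <# K \<in> sets M" by (simp add: eq sets_closedin topspace_eq)
    show "c \<otimes> x \<in> K" if "x \<in> inv c <# K" for x using that eq by simp
    have sub: "inv c <# K \<subseteq> V" using c(2) by (auto simp: E_def l_coset_def)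
    have "measure M (inv c <# K) = measure M K"
      using left_invariant[of "inv c" K] c Ks by (simp add: measure_def)
    then show "measure M (V - (inv c <# K)) < measure M V / 4"
      using finite_measure_Diff[OF sets_openin[OF V(1)] meas sub] V(3) by simp
  qed
  show thesis
  proof (rule that[OF U])
    fix a b assume ab: "a \<in> U" "b \<in> U"
    define F where "F = [\<one>, a, b, a \<otimes> b]"
    have abc: "a \<in> carrier G" "b \<in> carrier G" using ab Uc by auto
    have F: "c \<in> carrier G" "inv c \<in> E" if "c \<in> set F" for c
      using that ab abc UE UE1 E1 by (auto simp: F_def)
    let ?D = "\<lambda>c. V - (inv c <# K)"
    have D: "?D c \<in> sets M" "measure M (?D c) < measure M V / 4" if "c \<in> set F" for c
      using translate(1,2)[OF F[OF that]] sets_openin[OF V(1)] by auto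
    have in_F: "\<one> \<in> set F" "a \<in> set F" "b \<in> set F" "a \<otimes> b \<in> set F" by (auto simp: F_def)
    \<comment> \<open>Four sets, each of less than a quarter of the measure of \<open>V\<close>,
      cannot cover \<open>V\<close>. A point x of \<open>V\<close> outside all of them lies in every
      \<open>inv c <# K\<close>, so cx is in \<open>K\<close> for each of the four c.\<close>
    have "measure M (?D \<one> \<union> ?D a \<union> (?D b \<union> ?D (a \<otimes> b)))
      \<le> measure M (?D \<one>) + measure M (?D a) + (measure M (?D b) + measure M (?D (a \<otimes> b)))"
      using D(1) in_F
      by (intro order.trans[OF measure_Un_le] add_mono) (auto intro!: measure_Un_le sets.Un simp del: inv_one)
    also have "\<dots> < measure M V"
      using D(2)[OF in_F(1)] D(2)[OF in_F(2)] D(2)[OF in_F(3)] D(2)[OF in_F(4)] by linarith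
    finally have "?D \<one> \<union> ?D a \<union> (?D b \<union> ?D (a \<otimes> b)) \<noteq> V" by auto
    then obtain x where "x \<in> inv \<one> <# K" "x \<in> inv a <# K" "x \<in> inv b <# K" "x \<in> inv (a \<otimes> b) <# K"
      by auto
    then have x: "x \<in> inv c <# K" if "c \<in> set F" for c using that by (auto simp: F_def)
    have "c \<otimes> x \<in> S" if "c \<in> set F" for c
      using translate(3)[OF F[OF that] x[OF that]] K(2) by auto
    moreover have "x \<in> carrier G" using x[OF in_F(1)] Kc by (auto simp: l_coset_def)
    ultimately show "\<exists>x\<in>S. a \<otimes> x \<in> S \<and> b \<otimes> x \<in> S \<and> (a \<otimes> b) \<otimes> x \<in> S"
      using in_F by (metis l_one)
  qed
qed

text \<open>By compactness finitely many translates of \<open>H\<close> cover the group, so by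
  subadditivity they cannot all meet \<open>S\<close> in a null set.\<close>

lemma positive_measure_l_coset:
  assumes H: "openin T H" "\<one> \<in> H" and S: "S \<in> sets M" "measure M S > 0"
  obtains g where "g \<in> carrier G" "S \<inter> (g <# H) \<in> sets M" "measure M (S \<inter> (g <# H)) > 0"
proof -
  obtain F where F: "finite F" "F \<subseteq> carrier G" "carrier G = (\<Union>g\<in>F. g <# H)"
    using finite_l_coset_cover[OF H] .
  have meas: "S \<inter> (g <# H) \<in> sets M" if "g \<in> F" for g
    using S(1) sets_openin openin_l_coset[OF H(1)] F(2) that by blast
  have "S = (\<Union>g\<in>F. S \<inter> (g <# H))"
    using sets.sets_into_space[OF S(1)] F(3) space_eq by auto
  then have "measure M S \<le> (\<Sum>g\<in>F. measure M (S \<inter> (g <# H)))"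
    using finite_measure_subadditive_finite[OF F(1), of "\<lambda>g. S \<inter> (g <# H)"] meas by auto
  then have "\<not> (\<forall>g\<in>F. measure M (S \<inter> (g <# H)) \<le> 0)"
    using S(2) sum_nonpos[of F "\<lambda>g. measure M (S \<inter> (g <# H))"] by fastforce
  then show thesis using that F(2) meas by force
qed

end

section \<open>Automorphisms inverting a set of positive measure\<close>

theorem theorem3p1:
  fixes G :: "('a, 'b) monoid_scheme" and T :: "'a topology" and M :: "'a measure"
    and \<alpha> :: "'a \<Rightarrow> 'a" and X :: "'a set"
  assumes "compact_Hausdorff_group G T"
    and "normalized_Haar_measure G T M"
    and "\<alpha> \<in> iso G G"
    and "X = {x \<in> carrier G. \<alpha> x = inv\<^bsub>G\<^esub> x}"
    and "X \<in> sets (completion M)"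
    and "emeasure (completion M) X > 0"
  shows "(\<exists>N. N \<lhd> G \<and> openin T N \<and> comm_group (G\<lparr>carrier := N\<rparr>)) \<and>
    (profinite_group G T \<longrightarrow>
      (\<exists>A t. subgroup A G \<and> openin T A \<and> comm_group (G\<lparr>carrier := A\<rparr>) \<and>
             t \<in> X \<and> t <#\<^bsub>G\<^esub> A \<subseteq> X))"
proof -
  interpret normalized_Haar_measure G T M by fact
  note [simp] = m_assoc
  \<comment> \<open>With products nested to the right by \<open>m_assoc\<close>, an inverse pair may
    be followed by a further factor; these rules cancel it there.\<close>
  have cancel [simp]: "x \<otimes>\<^bsub>G\<^esub> (inv\<^bsub>G\<^esub> x \<otimes>\<^bsub>G\<^esub> y) = y" "inv\<^bsub>G\<^esub> x \<otimes>\<^bsub>G\<^esub> (x \<otimes>\<^bsub>G\<^esub> y) = y"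
    if "x \<in> carrier G" "y \<in> carrier G" for x y
    using that by (simp_all add: m_assoc[symmetric] del: m_assoc)
  have hom: "\<alpha> \<in> hom G G" using assms(3) by (simp add: iso_def)
  have \<alpha>_carrier [simp]: "\<alpha> x \<in> carrier G" if "x \<in> carrier G" for x
    using hom that by (auto simp: hom_def)
  have \<alpha>_mult: "\<alpha> (x \<otimes>\<^bsub>G\<^esub> y) = \<alpha> x \<otimes>\<^bsub>G\<^esub> \<alpha> y" if "x \<in> carrier G" "y \<in> carrier G" for x y
    using hom that by (auto simp: hom_def)
  have X: "x \<in> carrier G" "\<alpha> x = inv\<^bsub>G\<^esub> x" if "x \<in> X" for x using that assms(4) by auto

  \<comment> \<open>Apply \<alpha> to ax: its value is x^-1 a^-1 since ax is in \<open>X\<close>,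
    and also (\<alpha> a) x^-1 since x is in \<open>X\<close>.\<close>
  have conj: "\<alpha> a = inv\<^bsub>G\<^esub> x \<otimes>\<^bsub>G\<^esub> inv\<^bsub>G\<^esub> a \<otimes>\<^bsub>G\<^esub> x"
    if "a \<in> carrier G" "x \<in> X" "a \<otimes>\<^bsub>G\<^esub> x \<in> X" for a x
  proof -
    have "\<alpha> a \<otimes>\<^bsub>G\<^esub> inv\<^bsub>G\<^esub> x = inv\<^bsub>G\<^esub> x \<otimes>\<^bsub>G\<^esub> inv\<^bsub>G\<^esub> a"
      using X(2)[OF that(3)] X[OF that(2)] that(1) by (simp add: \<alpha>_mult inv_mult_group)
    then have "\<alpha> a \<otimes>\<^bsub>G\<^esub> inv\<^bsub>G\<^esub> x \<otimes>\<^bsub>G\<^esub> x = inv\<^bsub>G\<^esub> x \<otimes>\<^bsub>G\<^esub> inv\<^bsub>G\<^esub> a \<otimes>\<^bsub>G\<^esub> x" by simp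
    then show ?thesis using X(1)[OF that(2)] that(1) by simp
  qed

  \<comment> \<open>\<open>X\<close> is measurable only for the completion, while regularity and
    invariance are given for \<open>M\<close>. The main part is an \<open>M\<close>-measurable
    subset of \<open>X\<close> of the same measure.\<close>
  define S where "S = main_part M X"
  have S: "S \<in> sets M" "S \<subseteq> X"
    using main_part_sets[OF assms(5)] main_part_null_part_Un[OF assms(5)] by (auto simp: S_def)
  have "measure M S > 0"
    using assms(6) emeasure_completion[OF assms(5)]
    by (simp add: S_def emeasure_eq_measure)
  note S = S this

  \<comment> \<open>The open abelian subgroup and its normal core\<close>
  obtain U where U: "openin T U" "\<one>\<^bsub>G\<^esub> \<in> U"
    and US: "\<And>a b. a \<in> U \<Longrightarrow> b \<in> U \<Longrightarrow> \<exists>x\<in>S. a \<otimes>\<^bsub>G\<^esub> x \<in> S \<and> b \<otimes>\<^bsub>G\<^esub> x \<in> S \<and> (a \<otimes>\<^bsub>G\<^esub> b) \<otimes>\<^bsub>G\<^esub> x \<in> S"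
    using Steinhaus_parallelogram[OF S(1,3)] by metis
  have Uc: "U \<subseteq> carrier G" using openin_carrier[OF U(1)] .
  have commute: "a \<otimes>\<^bsub>G\<^esub> b = b \<otimes>\<^bsub>G\<^esub> a" if ab: "a \<in> U" "b \<in> U" for a b
  proof -
    obtain x where x: "x \<in> X" "a \<otimes>\<^bsub>G\<^esub> x \<in> X" "b \<otimes>\<^bsub>G\<^esub> x \<in> X" "(a \<otimes>\<^bsub>G\<^esub> b) \<otimes>\<^bsub>G\<^esub> x \<in> X"
      using US[OF ab] S(2) by blast
    have c: "a \<in> carrier G" "b \<in> carrier G" "x \<in> carrier G" using ab Uc X(1)[OF x(1)] by auto
    \<comment> \<open>Because one x serves a, b and ab, the product of \<alpha> a and \<alpha> b is
      x^-1 a^-1 b^-1 x, the conjugate of (ba)^-1, while \<alpha> (ab) is the same conjugate of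
      (ab)^-1.\<close>
    have "inv\<^bsub>G\<^esub> x \<otimes>\<^bsub>G\<^esub> (inv\<^bsub>G\<^esub> (a \<otimes>\<^bsub>G\<^esub> b) \<otimes>\<^bsub>G\<^esub> x) = \<alpha> a \<otimes>\<^bsub>G\<^esub> \<alpha> b"
      using conj[OF _ x(1,4)] c by (simp add: \<alpha>_mult)
    also have "\<dots> = inv\<^bsub>G\<^esub> x \<otimes>\<^bsub>G\<^esub> (inv\<^bsub>G\<^esub> (b \<otimes>\<^bsub>G\<^esub> a) \<otimes>\<^bsub>G\<^esub> x)"
      using conj[OF c(1) x(1,2)] conj[OF c(2) x(1,3)] c by (simp add: inv_mult_group)
    finally have "inv\<^bsub>G\<^esub> (a \<otimes>\<^bsub>G\<^esub> b) = inv\<^bsub>G\<^esub> (b \<otimes>\<^bsub>G\<^esub> a)"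
      using c by (simp add: Units_l_cancel right_cancel del: m_assoc)
    then show ?thesis using c by (metis inv_inv m_closed)
  qed
  obtain H where H: "subgroup H G" "U \<subseteq> H"
    and H_comm: "\<And>x y. x \<in> H \<Longrightarrow> y \<in> H \<Longrightarrow> x \<otimes>\<^bsub>G\<^esub> y = y \<otimes>\<^bsub>G\<^esub> x"
    using abelian_subgroup_of_commuting_set[OF Uc commute] by metis
  have Hc: "h \<in> carrier G" if "h \<in> H" for h using subgroup.mem_carrier[OF H(1) that] .
  have H_open: "openin T H" using openin_subgroup[OF H(1) U H(2)] .

  have normal: "core H \<lhd> G" "openin T (core H)" "comm_group (G\<lparr>carrier := core H\<rparr>)"
  proof -
    show 1: "core H \<lhd> G" by (rule normal_core[OF H(1)])
    show "openin T (core H)" by (rule openin_core[OF H_open])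
    show "comm_group (G\<lparr>carrier := core H\<rparr>)"
      using core_subset H_comm by (intro comm_group_subgroupI normal_imp_subgroup[OF 1]) blast
  qed

  \<comment> \<open>An open subgroup with a coset inside \<open>X\<close>\<close>
  obtain g where g: "g \<in> carrier G" "S \<inter> (g <#\<^bsub>G\<^esub> H) \<in> sets M" "measure M (S \<inter> (g <#\<^bsub>G\<^esub> H)) > 0"
    using positive_measure_l_coset[OF H_open subgroup.one_closed[OF H(1)] S(1,3)] .
  then obtain t where t: "t \<in> S" "t \<in> g <#\<^bsub>G\<^esub> H" by (metis Int_emptyI measure_empty less_irrefl)
  have tX: "t \<in> X" and tc [simp]: "t \<in> carrier G" using t S(2) X(1) by auto
  \<comment> \<open>Since t lies in gH, the cosets gH and tH coincide.\<close>
  have coset: "inv\<^bsub>G\<^esub> t \<otimes>\<^bsub>G\<^esub> y \<in> H" if y: "y \<in> g <#\<^bsub>G\<^esub> H" for y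
  proof -
    obtain h k where "h \<in> H" "k \<in> H" "t = g \<otimes>\<^bsub>G\<^esub> h" "y = g \<otimes>\<^bsub>G\<^esub> k"
      using t(2) y by (auto simp: l_coset_def)
    then show ?thesis
      using g(1) subgroup.m_closed[OF H(1) subgroup.m_inv_closed[OF H(1)]]
      by (simp add: Hc inv_mult_group)
  qed

  define A where "A = {n \<in> H. t \<otimes>\<^bsub>G\<^esub> n \<in> X}"
  \<comment> \<open>As t is in \<open>X\<close>, \<alpha> (tn) is t^-1 (\<alpha> n); setting this
    equal to n^-1 t^-1 gives the equation. Its right-hand side is a homomorphism in n on the abelian
    group \<open>H\<close>, so \<open>A\<close> is where it agrees with \<alpha>.\<close>
  have A_iff: "n \<in> A \<longleftrightarrow> n \<in> H \<and> \<alpha> n = t \<otimes>\<^bsub>G\<^esub> inv\<^bsub>G\<^esub> n \<otimes>\<^bsub>G\<^esub> inv\<^bsub>G\<^esub> t" for n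
  proof -
    have "\<alpha> (t \<otimes>\<^bsub>G\<^esub> n) = inv\<^bsub>G\<^esub> (t \<otimes>\<^bsub>G\<^esub> n) \<longleftrightarrow> \<alpha> n = t \<otimes>\<^bsub>G\<^esub> inv\<^bsub>G\<^esub> n \<otimes>\<^bsub>G\<^esub> inv\<^bsub>G\<^esub> t" if n: "n \<in> carrier G"
    proof -
      have "\<alpha> (t \<otimes>\<^bsub>G\<^esub> n) = inv\<^bsub>G\<^esub> t \<otimes>\<^bsub>G\<^esub> \<alpha> n" using n X(2)[OF tX] by (simp add: \<alpha>_mult)
      moreover have "inv\<^bsub>G\<^esub> (t \<otimes>\<^bsub>G\<^esub> n) = inv\<^bsub>G\<^esub> t \<otimes>\<^bsub>G\<^esub> (t \<otimes>\<^bsub>G\<^esub> inv\<^bsub>G\<^esub> n \<otimes>\<^bsub>G\<^esub> inv\<^bsub>G\<^esub> t)"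
        using n by (simp add: inv_mult_group)
      ultimately show ?thesis using n by (simp del: m_assoc)
    qed
    then show ?thesis using Hc by (auto simp: A_def assms(4))
  qed
  have A: "subgroup A G"
  proof (rule subgroupI)
    show "A \<subseteq> carrier G" using Hc by (auto simp: A_def)
    show "A \<noteq> {}" using tX subgroup.one_closed[OF H(1)] by (auto simp: A_def)
  next
    fix n assume n: "n \<in> A"
    then have nH: "n \<in> H" "n \<in> carrier G" and eq: "\<alpha> n = t \<otimes>\<^bsub>G\<^esub> inv\<^bsub>G\<^esub> n \<otimes>\<^bsub>G\<^esub> inv\<^bsub>G\<^esub> t"
      using Hc by (auto simp: A_iff)
    have "\<alpha> (inv\<^bsub>G\<^esub> n) = inv\<^bsub>G\<^esub> (\<alpha> n)"
      using group_hom.hom_inv[of G G \<alpha> n] hom nH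
      by (simp add: group_hom_def group_hom_axioms_def)
    then show "inv\<^bsub>G\<^esub> n \<in> A"
      using nH subgroup.m_inv_closed[OF H(1)] by (simp add: A_iff eq inv_mult_group)
  next
    fix n m assume "n \<in> A" "m \<in> A"
    then have nm: "n \<in> H" "m \<in> H" "n \<in> carrier G" "m \<in> carrier G"
      and eq: "\<alpha> n = t \<otimes>\<^bsub>G\<^esub> inv\<^bsub>G\<^esub> n \<otimes>\<^bsub>G\<^esub> inv\<^bsub>G\<^esub> t" "\<alpha> m = t \<otimes>\<^bsub>G\<^esub> inv\<^bsub>G\<^esub> m \<otimes>\<^bsub>G\<^esub> inv\<^bsub>G\<^esub> t"
      using Hc by (auto simp: A_iff)
    \<comment> \<open>Inversion reverses the factors, so mn appears where membership of nm in
      \<open>A\<close> asks for nm; commutativity of \<open>H\<close> closes the gap.\<close>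
    have "\<alpha> (n \<otimes>\<^bsub>G\<^esub> m) = t \<otimes>\<^bsub>G\<^esub> inv\<^bsub>G\<^esub> (m \<otimes>\<^bsub>G\<^esub> n) \<otimes>\<^bsub>G\<^esub> inv\<^bsub>G\<^esub> t"
      using nm by (simp add: \<alpha>_mult eq inv_mult_group)
    then show "n \<otimes>\<^bsub>G\<^esub> m \<in> A"
      using nm H_comm[of n m] subgroup.m_closed[OF H(1)] by (simp add: A_iff)
  qed

  obtain W where W: "openin T W" "\<one>\<^bsub>G\<^esub> \<in> W"
    and WS: "\<And>a b. a \<in> W \<Longrightarrow> b \<in> W \<Longrightarrow> \<exists>x\<in>S \<inter> (g <#\<^bsub>G\<^esub> H). a \<otimes>\<^bsub>G\<^esub> x \<in> S \<inter> (g <#\<^bsub>G\<^esub> H) \<and>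
      b \<otimes>\<^bsub>G\<^esub> x \<in> S \<inter> (g <#\<^bsub>G\<^esub> H) \<and> (a \<otimes>\<^bsub>G\<^esub> b) \<otimes>\<^bsub>G\<^esub> x \<in> S \<inter> (g <#\<^bsub>G\<^esub> H)"
    using Steinhaus_parallelogram[OF g(2,3)] by metis
  \<comment> \<open>Steinhaus gives left translations, while \<open>A\<close> is measured from t on
    the right. Conjugating by t translates between the two: if x = tm, then (t n t^-1) x =
    t(nm).\<close>
  let ?W = "{n \<in> topspace T. t \<otimes>\<^bsub>G\<^esub> n \<otimes>\<^bsub>G\<^esub> inv\<^bsub>G\<^esub> t \<in> W}"
  have "?W \<subseteq> A"
  proof
    fix n assume n: "n \<in> ?W"
    then have nc: "n \<in> carrier G" by (simp add: topspace_eq)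
    \<comment> \<open>Taking b = \<open>\<one>\<close> yields x such that x and (t n t^-1) x both
      lie in \<open>S\<close> and in gH. With m = t^-1 x, both m and nm are then in the subgroup
      \<open>A\<close>, hence so is n.\<close>
    obtain x where x: "x \<in> S" "x \<in> g <#\<^bsub>G\<^esub> H"
      "t \<otimes>\<^bsub>G\<^esub> n \<otimes>\<^bsub>G\<^esub> inv\<^bsub>G\<^esub> t \<otimes>\<^bsub>G\<^esub> x \<in> S" "t \<otimes>\<^bsub>G\<^esub> n \<otimes>\<^bsub>G\<^esub> inv\<^bsub>G\<^esub> t \<otimes>\<^bsub>G\<^esub> x \<in> g <#\<^bsub>G\<^esub> H"
      using WS[OF _ W(2), of "t \<otimes>\<^bsub>G\<^esub> n \<otimes>\<^bsub>G\<^esub> inv\<^bsub>G\<^esub> t"] n by (auto simp del: m_assoc)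
    define m where "m = inv\<^bsub>G\<^esub> t \<otimes>\<^bsub>G\<^esub> x"
    have xc: "x \<in> carrier G" using x(1) S(2) X(1) by blast
    have "t \<otimes>\<^bsub>G\<^esub> m \<in> X" using x(1) S(2) xc by (auto simp: m_def)
    then have m: "m \<in> A" using coset[OF x(2)] by (simp add: A_def m_def)
    have "t \<otimes>\<^bsub>G\<^esub> (n \<otimes>\<^bsub>G\<^esub> m) \<in> X" using x(3) S(2) xc nc by (auto simp: m_def)
    moreover have "n \<otimes>\<^bsub>G\<^esub> m \<in> H" using coset[OF x(4)] nc xc by (simp add: m_def)
    ultimately have nm: "n \<otimes>\<^bsub>G\<^esub> m \<in> A" by (simp add: A_def)
    have mc: "m \<in> carrier G" using xc by (simp add: m_def)
    have "n = (n \<otimes>\<^bsub>G\<^esub> m) \<otimes>\<^bsub>G\<^esub> inv\<^bsub>G\<^esub> m" using nc mc by simp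
    then show "n \<in> A"
      using subgroup.m_closed[OF A nm subgroup.m_inv_closed[OF A m]] by simp
  qed
  moreover have "openin T ?W"
    by (rule openin_continuous_map_preimage[OF _ W(1)])
      (intro continuous_map_mult continuous_map_const_carrier continuous_map_id[unfolded id_def] tc inv_closed)
  moreover have "\<one>\<^bsub>G\<^esub> \<in> ?W" using W(2) by (simp add: topspace_eq)
  ultimately have "openin T A" using openin_subgroup[OF A] by blast
  moreover have "comm_group (G\<lparr>carrier := A\<rparr>)"
    using H_comm by (intro comm_group_subgroupI[OF A]) (auto simp: A_def)
  moreover have "t <#\<^bsub>G\<^esub> A \<subseteq> X" by (auto simp: l_coset_def A_def)
  ultimately show ?thesis using normal A tX by blast
qed

end
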